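(* Let $n$ and $r\ge 2$ be integers. The maximum independence number of an almost self-centered graph of order $n$ and radius $r$ is $n-r$.
   Context: All graphs are finite and simple. For a connected graph $G$, the eccentricity of a vertex $v$ is $\max_{u\in V(G)} d(v,u)$; the radius is the minimum eccentricity. A central vertex is one whose eccentricity equals the radius. A connected graph of order $n$ is almost self-centered if it has exactly $n-2$ central vertices. The independence number is the maximum size of a set of pairwise nonadjacent vertices.
   Formalization: The formal theorem assumes that at least one almost self-centered graph of order n and radius r exists; for other integers n (for example n = 3, r = 2) there is no such graph, so the maximum is undefined. *)

theory Defs
  imports "Graph_Theory.Graph_Theory"
begin

(* A finite simple graph is a pair_graph: finite vertex set and a symmetric, irreflexive
   arc relation, each undirected edge being represented by its two opposite arcs. *)

(* With unit arc weights, the weighted distance of the library is the length of a shortest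
   walk; it is infinite iff there is no walk. *)
definition gdist :: "'a pair_pre_digraph \<Rightarrow> 'a \<Rightarrow> 'a \<Rightarrow> ereal" where
  "gdist G u v = wf_digraph.\<mu> (with_proj G) (\<lambda>_. 1) u v"

definition eccentricity :: "'a pair_pre_digraph \<Rightarrow> 'a \<Rightarrow> ereal" where
  "eccentricity G v = Max (gdist G v ` pverts G)"

definition radius :: "'a pair_pre_digraph \<Rightarrow> ereal" where
  "radius G = Min (eccentricity G ` pverts G)"

definition central_vertices :: "'a pair_pre_digraph \<Rightarrow> 'a set" where
  "central_vertices G = {v \<in> pverts G. eccentricity G v = radius G}"

(* The cardinality condition is additive to avoid truncated subtraction on nat.
   Connectedness entails that the vertex set is nonempty. *)
definition almost_self_centered :: "'a pair_pre_digraph \<Rightarrow> bool" where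
  "almost_self_centered G \<longleftrightarrow>
     pair_graph G \<and> Digraph_Component.connected (with_proj G) \<and>
     card (central_vertices G) + 2 = card (pverts G)"

definition independent_set :: "'a pair_pre_digraph \<Rightarrow> 'a set \<Rightarrow> bool" where
  "independent_set G S \<longleftrightarrow> S \<subseteq> pverts G \<and> pairwise (\<lambda>u v. (u, v) \<notin> parcs G) S"

definition independence_number :: "'a pair_pre_digraph \<Rightarrow> nat" where
  "independence_number G = Max (card ` {S. independent_set G S})"

definition asc_graphs :: "nat \<Rightarrow> nat \<Rightarrow> 'a pair_pre_digraph set" where
  "asc_graphs n r =
     {G. almost_self_centered G \<and> card (pverts G) = n \<and> radius G = ereal (real r)}"

end

theory Submission
  imports Defs
begin

text \<open>
  Upper bound: a connected graph of radius \<open>r\<close> contains a path on \<open>2 * r\<close> vertices, because the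
  middle of a longest path would otherwise have eccentricity below \<open>r\<close>. An independent set misses
  at least one vertex of each of the \<open>r\<close> disjoint edges of such a path.

  Attainment: if \<open>n = 2 * r\<close>, the path is Hamiltonian and every chord joins positions of different
  parity (a chord joining equal parities would produce a vertex of eccentricity below \<open>r\<close>), so the
  even positions of any graph in the class are independent. If \<open>n > 2 * r\<close>, take the cycle on \<open>2 * r\<close>
  vertices with one pendant vertex and replace a neighbour of the attachment point by
  nonadjacent twins; the \<open>r\<close> cycle vertices of even position are a vertex cover.
\<close>

section \<open>Walks and distances\<close>

context pair_wf_digraph
begin

lemma awalk_imp_relpow:
  "awalk u p v \<Longrightarrow> (u, v) \<in> parcs G ^^ length p"
proof (induction p arbitrary: u)
  case Nil
  then show ?case by (simp add: awalk_def)
next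
  case (Cons e p)
  then have "e \<in> parcs G" "fst e = u" "(snd e, v) \<in> parcs G ^^ length p"
    by (auto simp: awalk_Cons_iff)
  then show ?case
    by (metis length_Cons prod.collapse relpow_Suc_I2)
qed

lemma relpow_imp_awalk:
  "(u, v) \<in> parcs G ^^ k \<Longrightarrow> u \<in> pverts G \<Longrightarrow> \<exists>p. awalk u p v \<and> length p = k"
proof (induction k arbitrary: u)
  case 0
  then show ?case by (auto intro!: exI[of _ "[]"] simp: awalk_def)
next
  case (Suc k)
  then obtain w where w: "(u, w) \<in> parcs G" "(w, v) \<in> parcs G ^^ k"
    by (meson relpow_Suc_D2)
  then obtain p where "awalk w p v" "length p = k"
    using Suc.IH in_arcsD2 by blast
  with w show ?case
    by (auto intro!: exI[of _ "(u, w) # p"] simp: awalk_Cons_iff)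
qed

lemma awalk_cost_unit: "awalk_cost (\<lambda>_. 1) p = length p"
  by (induction p) auto

lemma gdist_le_walk:
  assumes "(u, v) \<in> parcs G ^^ k" "u \<in> pverts G"
  shows "gdist G u v \<le> ereal k"
proof -
  obtain p where "awalk u p v" "length p = k"
    using relpow_imp_awalk[OF assms] by blast
  then show ?thesis
    using min_cost_le_walk_cost[of u p v "\<lambda>_. 1"]
    by (simp add: gdist_def awalk_cost_unit)
qed

lemma gdist_ge:
  assumes "\<And>k. (u, v) \<in> parcs G ^^ k \<Longrightarrow> c \<le> k"
  shows "ereal c \<le> gdist G u v"
  unfolding gdist_def \<mu>_def
proof (rule INF_greatest)
  fix p assume "p \<in> {p. awalk u p v}"
  then have "c \<le> length p"
    using assms awalk_imp_relpow by blast
  then show "ereal c \<le> ereal (awalk_cost (\<lambda>_. 1) p)"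
    by (simp add: awalk_cost_unit)
qed

end

lemma sym_relpow: "sym E \<Longrightarrow> sym (E ^^ k)" for E :: "'a rel"
proof (induction k)
  case (Suc k)
  then show ?case
    unfolding sym_def by (metis relpow_Suc_D2 relpow_Suc_I)
qed (simp add: sym_def)

section \<open>Connectivity and radius through powers of the arc relation\<close>

context pair_graph
begin

lemma sym_parcs: "sym (parcs G)"
  using arcs_symmetric by (auto simp: sym_def)

text \<open>Arcs are symmetric with both ends in \<open>pverts G\<close>, so neither symmetric
  closure nor restriction to the vertex set changes reachability.\<close>

lemma connected_iff_rtrancl:
  "Digraph_Component.connected (with_proj G) \<longleftrightarrow>
    pverts G \<noteq> {} \<and> (\<forall>u\<in>pverts G. \<forall>v\<in>pverts G. (u, v) \<in> (parcs G)\<^sup>*)"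
proof -
  have "symcl (parcs G) = parcs G"
    using sym_parcs by (auto simp: symcl_def sym_def)
  moreover have "(u, v) \<in> rtrancl_on (pverts G) (parcs G) \<longleftrightarrow> (u, v) \<in> (parcs G)\<^sup>*"
    if u: "u \<in> pverts G" for u v
  proof
    assume "(u, v) \<in> (parcs G)\<^sup>*"
    then show "(u, v) \<in> rtrancl_on (pverts G) (parcs G)"
      by induction (use u in \<open>auto intro: rtrancl_on_into_rtrancl_on in_arcsD2 in_arcsD1\<close>)
  qed (rule rtrancl_on_rtranclI)
  ultimately show ?thesis
    by (auto simp: connected_conv)
qed

text \<open>The maximum defining the eccentricity of \<open>v\<close> is attained at some
  \<open>u\<close>. Phrased by walk lengths so that the path arguments avoid extended reals.\<close>

lemma walk_ge_radius:
  assumes "radius G = ereal r" "v \<in> pverts G"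
  shows "\<exists>u\<in>pverts G. \<forall>k<r. (v, u) \<notin> parcs G ^^ k"
proof -
  have "ereal r \<le> eccentricity G v"
    using assms pair_finite_verts unfolding radius_def
    by (metis Min_le finite_imageI imageI)
  moreover have "eccentricity G v \<in> gdist G v ` pverts G"
    unfolding eccentricity_def using assms pair_finite_verts by (intro Max_in) auto
  ultimately obtain u where u: "u \<in> pverts G" "ereal r \<le> gdist G v u"
    by auto
  have "(v, u) \<notin> parcs G ^^ k" if "k < r" for k
    using gdist_le_walk[of v u k] u assms(2) that by (auto dest: order_trans)
  with u show ?thesis by blast
qed

end

section \<open>Long paths in graphs of given radius\<close>

definition is_path :: "'a rel \<Rightarrow> 'a list \<Rightarrow> bool" where
  "is_path E xs \<longleftrightarrow> distinct xs \<and> successively (\<lambda>x y. (x, y) \<in> E) xs"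

lemma walk_along_path:
  assumes "is_path E xs" "i \<le> j" "j < length xs"
  shows "(xs ! i, xs ! j) \<in> E ^^ (j - i)"
  using assms(2,3)
proof (induction j rule: dec_induct)
  case (step j)
  then have "(xs ! j, xs ! Suc j) \<in> E"
    using assms(1) by (auto simp: is_path_def successively_conv_nth)
  with step show ?case
    by (metis Suc_diff_le Suc_lessD relpow_Suc_I)
qed simp

lemma walk_along_path':
  assumes "is_path E xs" "sym E" "i < length xs" "j < length xs"
  shows "(xs ! i, xs ! j) \<in> E ^^ nat \<bar>int i - int j\<bar>"
proof (cases "i \<le> j")
  case True
  then show ?thesis using walk_along_path[OF assms(1), of i j] assms by (simp add: nat_diff_distrib)
next
  case False
  then have "(xs ! j, xs ! i) \<in> E ^^ (i - j)"
    using walk_along_path[OF assms(1), of j i] assms by simp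
  then show ?thesis using False sym_relpow[OF assms(2), of "i - j"]
    by (auto simp: sym_def nat_diff_distrib)
qed

lemma is_path_take: "is_path E xs \<Longrightarrow> is_path E (take k xs)"
  by (auto simp: is_path_def successively_conv_nth)

lemma is_path_drop: "is_path E xs \<Longrightarrow> is_path E (drop k xs)"
  by (auto simp: is_path_def successively_conv_nth)

lemma is_path_rev: "sym E \<Longrightarrow> is_path E xs \<Longrightarrow> is_path E (rev xs)"
  by (auto simp: is_path_def sym_def elim!: successively_mono)

lemma is_path_append:
  "is_path E xs \<Longrightarrow> is_path E ys \<Longrightarrow> set xs \<inter> set ys = {} \<Longrightarrow> xs \<noteq> [] \<Longrightarrow> ys \<noteq> []
    \<Longrightarrow> (last xs, hd ys) \<in> E \<Longrightarrow> is_path E (xs @ ys)"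
  by (auto simp: is_path_def successively_append_iff)

text \<open>A shortest walk from \<open>u\<close> to \<open>P\<close> repeats no vertex and meets
  \<open>P\<close> only at its end. \<open>ys\<close> omits that end, so it is empty when
  \<open>u\<close> lies in \<open>P\<close>.\<close>

lemma shortest_path_to_set:
  assumes "(u, q) \<in> E\<^sup>*" "q \<in> P" "E \<subseteq> V \<times> V" "u \<in> V"
  obtains ys p where "is_path E (ys @ [p])" "p \<in> P" "set ys \<inter> P = {}" "set ys \<subseteq> V"
    "(u, p) \<in> E ^^ length ys"
proof -
  let ?Q = "\<lambda>k. \<exists>p\<in>P. (u, p) \<in> E ^^ k"
  define a where "a = (LEAST k. ?Q k)"
  have "\<exists>k. ?Q k"
    using assms(1,2) rtrancl_power by blast
  then have "?Q a"
    unfolding a_def by (rule LeastI_ex)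
  then obtain p where p: "p \<in> P" "(u, p) \<in> E ^^ a" by blast
  then obtain f where f: "f 0 = u" "f a = p" "\<And>i. i < a \<Longrightarrow> (f i, f (Suc i)) \<in> E"
    by (auto simp: relpow_fun_conv)
  have min: "a \<le> k" if "?Q k" for k
    unfolding a_def using that by (rule Least_le)
  have walk: "(f i, f j) \<in> E ^^ (j - i)" if "i \<le> j" "j \<le> a" for i j
    using that
    by (subst relpow_fun_conv) (auto intro!: exI[of _ "\<lambda>k. f (i + k)"] f)
  have *: "f i \<notin> P" if "i < a" for i
    using min[of i] walk[of 0 i] that f(1) by auto
  \<comment> \<open>Cutting out a loop between equal entries would leave a walk shorter than the
    least length \<open>a\<close>.\<close>
  have inj: "i = j" if "i \<le> j" "j \<le> a" "f i = f j" for i j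
  proof -
    have "(u, p) \<in> E ^^ (i + (a - j))"
      using walk[of 0 i] walk[of j a] that f(1,2) unfolding relpow_add by auto
    then have "a \<le> i + (a - j)" using min p(1) by blast
    then show ?thesis using that by linarith
  qed
  have "inj_on f {0..<Suc a}"
    by (rule inj_onI) (metis atLeastLessThan_iff inj less_Suc_eq_le linear)
  then have "is_path E (map f [0..<Suc a])"
    unfolding is_path_def distinct_map
    by (auto simp: successively_conv_nth f nth_append simp del: upt_Suc)
  moreover have "f i \<in> V" if "i < a" for i
    using f(3)[OF that] assms(3) by auto
  ultimately show thesis
    using p * f(2) by (intro that[of "map f [0..<a]" p]) auto
qed

text \<open>
  The middle vertex of a longest path is within distance half its length of every vertex,
  since a vertex further away would yield a longer path.
\<close>
lemma long_path_exists:
  assumes "finite V" "V \<noteq> {}" "E \<subseteq> V \<times> V" "sym E"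
    and conn: "\<And>u v. u \<in> V \<Longrightarrow> v \<in> V \<Longrightarrow> (u, v) \<in> E\<^sup>*"
    and rad: "\<And>v. v \<in> V \<Longrightarrow> \<exists>u\<in>V. \<forall>k<r. (v, u) \<notin> E ^^ k"
  obtains xs where "is_path E xs" "set xs \<subseteq> V" "length xs = 2 * r"
proof -
  let ?P = "\<lambda>xs. is_path E xs \<and> set xs \<subseteq> V"
  have bounded: "length xs \<le> card V" if "?P xs" for xs
    using that assms(1) by (metis card_mono distinct_card is_path_def)
  have "\<exists>xs. ?P xs \<and> (\<forall>ys. ?P ys \<longrightarrow> length ys \<le> length xs)"
    by (rule ex_has_greatest_nat[where k = "[]" and b = "Suc (card V)"])
       (use bounded in \<open>auto simp: is_path_def less_Suc_eq_le\<close>)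
  then obtain xs where xs: "?P xs" and max: "\<And>ys. ?P ys \<Longrightarrow> length ys \<le> length xs"
    by blast
  obtain v0 where "v0 \<in> V" using assms(2) by blast
  then have ne: "xs \<noteq> []"
    using max[of "[v0]"] by (auto simp: is_path_def)
  have "2 * r \<le> length xs"
  proof (rule ccontr)
    assume short: "\<not> 2 * r \<le> length xs"
    \<comment> \<open>With at most \<open>2 * r - 1\<close> vertices, both ends of \<open>xs\<close>
      are within \<open>r - 1\<close> steps of index \<open>m\<close>.\<close>
    define m where "m = (length xs - 1) div 2"
    have m: "m < length xs" "m < r" "length xs - 1 - m < r"
      using short ne unfolding m_def by (cases xs; simp; linarith)+
    have mV: "xs ! m \<in> V" using m xs by auto
    obtain u where u: "u \<in> V" "\<And>k. k < r \<Longrightarrow> (xs ! m, u) \<notin> E ^^ k"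
      using rad[OF mV] by blast
    obtain ys p where ys: "is_path E (ys @ [p])" "p \<in> set xs" "set ys \<inter> set xs = {}"
      "set ys \<subseteq> V" "(u, p) \<in> E ^^ length ys"
      using shortest_path_to_set[OF conn[OF u(1) mV], of "set xs"] m(1) assms(3) u(1)
      by (metis nth_mem)
    obtain i where i: "i < length xs" "xs ! i = p"
      using ys(2) by (meson in_set_conv_nth)
    \<comment> \<open>Prepending \<open>ys\<close> to a part of \<open>xs\<close> that starts in
      \<open>p\<close> gives a path again, so maximality bounds its length.\<close>
    have extend: "length ys + length zs \<le> length xs"
      if "is_path E zs" "set zs \<subseteq> set xs" "zs \<noteq> []" "hd zs = p" for zs
    proof (cases "ys = []")
      case True
      then show ?thesis
        using that xs max[of zs] by auto
    next
      case False
      have "is_path E (ys @ zs)"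
      proof (rule is_path_append)
        show "is_path E ys" using is_path_take[OF ys(1), of "length ys"] by simp
        show "(last ys, hd zs) \<in> E"
          using ys(1) False that(4) by (auto simp: is_path_def successively_append_iff)
      qed (use that ys False in auto)
      moreover have "set (ys @ zs) \<subseteq> V" using that ys xs by auto
      ultimately show ?thesis using max[of "ys @ zs"] by simp
    qed
    \<comment> \<open>The two parts of \<open>xs\<close> leaving \<open>p\<close> give
      \<open>length ys \<le> i\<close> and \<open>length ys \<le> length xs - 1 - i\<close>. So
      going from \<open>u\<close> via \<open>p\<close> to index \<open>m\<close> costs no more than
      coming from an end of \<open>xs\<close>.\<close>
    have "length ys + length (drop i xs) \<le> length xs"
      using i xs by (intro extend) (auto simp: is_path_drop hd_drop_conv_nth dest: in_set_dropD)
    moreover have "length ys + length (rev (take (Suc i) xs)) \<le> length xs"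
    proof (rule extend)
      show "is_path E (rev (take (Suc i) xs))"
        using xs assms(4) by (intro is_path_rev is_path_take) auto
    qed (use i in \<open>auto simp: take_Suc_conv_app_nth dest: in_set_takeD\<close>)
    ultimately have "length ys + nat \<bar>int i - int m\<bar> < r"
      using i(1) m by auto
    moreover have "(u, xs ! m) \<in> E ^^ (length ys + nat \<bar>int i - int m\<bar>)"
      using walk_along_path'[of E xs i m] xs assms(4) i m ys(5) by (auto simp: relpow_add)
    ultimately show False
      using u(2) sym_relpow[OF assms(4)] by (meson symD)
  qed
  then show thesis
    using that[of "take (2 * r) xs"] xs by (auto simp: is_path_take dest: in_set_takeD)
qed

text \<open>Positions \<open>2*i\<close> and \<open>Suc (2*i)\<close> form \<open>r\<close> disjoint
  edges, each with an end outside \<open>S\<close>.\<close>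

lemma independent_meets_path:
  assumes "is_path E xs" "length xs = 2 * r" "finite V" "set xs \<subseteq> V"
    and S: "S \<subseteq> V" "pairwise (\<lambda>u v. (u, v) \<notin> E) S"
  shows "card S + r \<le> card V"
proof -
  have "\<exists>x\<in>{xs ! (2*i), xs ! Suc (2*i)}. x \<notin> S" if "i < r" for i
  proof -
    have "(xs ! (2*i), xs ! Suc (2*i)) \<in> E" "xs ! (2*i) \<noteq> xs ! Suc (2*i)"
      using assms(1,2) that by (auto simp: is_path_def successively_conv_nth nth_eq_iff_index_eq)
    then show ?thesis using S(2) by (auto simp: pairwise_def)
  qed
  then have "\<forall>i. \<exists>k. i < r \<longrightarrow> k \<in> {2*i, Suc (2*i)} \<and> xs ! k \<notin> S" by blast
  \<comment> \<open>Halving the chosen position \<open>k i\<close> recovers \<open>i\<close>, whence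
    the injectivity below.\<close>
  then obtain k where k: "\<And>i. i < r \<Longrightarrow> k i \<in> {2*i, Suc (2*i)} \<and> xs ! k i \<notin> S" by metis
  have lt: "k i < length xs" if "i < r" for i using k[OF that] assms(2) that by auto
  have "inj_on (\<lambda>i. xs ! k i) {..<r}"
  proof (rule inj_onI)
    fix i j assume ij: "i \<in> {..<r}" "j \<in> {..<r}" "xs ! k i = xs ! k j"
    then have "k i = k j" using lt assms(1) by (auto simp: is_path_def nth_eq_iff_index_eq)
    moreover have "k i = 2*i \<or> k i = Suc (2*i)" "k j = 2*j \<or> k j = Suc (2*j)"
      using k ij by auto
    ultimately show "i = j" by presburger
  qed
  then have "r = card ((\<lambda>i. xs ! k i) ` {..<r})" by (simp add: card_image)
  also have "\<dots> \<le> card (V - S)"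
    using k lt assms(3,4) by (intro card_mono) (auto intro!: subsetD[OF assms(4)])
  also have "\<dots> = card V - card S"
    using S(1) assms(3) by (meson card_Diff_subset finite_subset)
  finally show ?thesis using card_mono[OF assms(3) S(1)] by linarith
qed

section \<open>The smallest order\<close>

text \<open>An even chord closes an odd cycle with the path and saves at least one step;
  \<open>c\<close> is a middle vertex or the chord end \<open>j\<close>.\<close>

lemma even_chord_small_eccentricity:
  assumes path: "is_path E xs" "length xs = 2 * r" and "sym E"
    and ij: "i < j" "j < 2 * r" "even (j - i)" "(xs ! i, xs ! j) \<in> E"
  shows "\<exists>c<2 * r. \<forall>k<2 * r. \<exists>l<r. (xs ! c, xs ! k) \<in> E ^^ l"
proof -
  \<comment> \<open>The bound \<open>d\<close> is an integer so that subtractions do not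
    truncate.\<close>
  define W where "W a b d \<longleftrightarrow> (\<exists>l. int l \<le> d \<and> (xs ! a, xs ! b) \<in> E ^^ l)" for a b d
  have seg: "W a b d" if "a < 2*r" "b < 2*r" "\<bar>int a - int b\<bar> \<le> d" for a b d
    unfolding W_def using walk_along_path'[OF path(1) assms(3), of a b] that path(2)
    by (intro exI[of _ "nat \<bar>int a - int b\<bar>"]) auto
  have trans: "W a c (d + e)" if ab: "W a b d" and bc: "W b c e" for a b c d e
  proof -
    obtain l l' where "int l \<le> d" "(xs ! a, xs ! b) \<in> E ^^ l" "int l' \<le> e" "(xs ! b, xs ! c) \<in> E ^^ l'"
      using ab bc unfolding W_def by blast
    then show ?thesis unfolding W_def by (intro exI[of _ "l + l'"]) (auto simp: relpow_add)
  qed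
  have chord: "W i j 1" "W j i 1"
    unfolding W_def using ij(4) \<open>sym E\<close> by (auto intro!: exI[of _ "1::nat"] dest: symD)
  \<comment> \<open>Detours across the chord, from \<open>i\<close> to \<open>j\<close> here and
    from \<open>j\<close> to \<open>i\<close> in \<open>down\<close>.\<close>
  have up: "W a b d"
    if "a < 2*r" "b < 2*r" "\<bar>int a - int i\<bar> + 1 + \<bar>int j - int b\<bar> \<le> d" for a b d
    using trans[OF trans[OF seg chord(1)] seg, of a "\<bar>int a - int i\<bar>" b "d - \<bar>int a - int i\<bar> - 1"]
      that ij by auto
  have down: "W a b d"
    if "a < 2*r" "b < 2*r" "\<bar>int a - int j\<bar> + 1 + \<bar>int i - int b\<bar> \<le> d" for a b d
    using trans[OF trans[OF seg chord(2)] seg, of a "\<bar>int a - int j\<bar>" b "d - \<bar>int a - int j\<bar> - 1"]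
      that ij by auto
  obtain h where h: "j = i + 2 * h"
    using ij(1,3) by (metis evenE le_add_diff_inverse less_imp_le)
  then have gap: "i + 2 \<le> j" using ij(1) by presburger
  have "\<exists>c<2 * r. \<forall>k<2 * r. W c k (int r - 1)"
  proof -
    \<comment> \<open>Chord on the left, on the right, or across the middle. The first two cases
      take the middle vertex \<open>r\<close> or \<open>r - 1\<close> whose only vertex at path
      distance \<open>r\<close> lies at or beyond the far chord end.\<close>
    consider "j \<le> r" "r < 2 * r" | "r \<le> Suc i" | "Suc i < r" "r < j" using ij by linarith
    then show ?thesis
    proof cases
      case 1
      have "W r k (int r - 1)" if "k < 2 * r" for k
      proof (cases "k = 0 \<or> k \<le> i")
        case True
        show ?thesis by (rule down) (use True 1 that gap in auto)
      next
        case False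
        show ?thesis by (rule seg) (use False 1 that in auto)
      qed
      then show ?thesis using 1 by blast
    next
      case 2
      have "W (r - 1) k (int r - 1)" if "k < 2 * r" for k
      proof (cases "k < j")
        case True
        show ?thesis by (rule seg) (use True ij 2 that in auto)
      next
        case False
        show ?thesis by (rule up) (use False ij 2 that gap in auto)
      qed
      then show ?thesis using ij by (intro exI[of _ "r - 1"]) auto
    next
      case 3
      \<comment> \<open>Positions from \<open>i\<close> to \<open>j\<close> lie on a cycle of odd
        length \<open>2 * h + 1\<close>, so \<open>h \<le> r - 1\<close> steps reach those strictly
        between.\<close>
      have "W j k (int r - 1)" if "k < 2 * r" for k
      proof -
        consider "k \<le> i" | "j \<le> k" | "i < k" "k < j" "j - k \<le> h" | "i < k" "k < j" "h < j - k"
          by linarith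
        then show ?thesis
        proof cases
          case 1
          show ?thesis by (rule down) (use 1 3 ij in auto)
        next
          case 2
          show ?thesis by (rule seg) (use 2 3 ij that in auto)
        next
          case k: 3
          show ?thesis by (rule seg) (use k h ij that in auto)
        next
          case k: 4
          show ?thesis by (rule down) (use k h ij that in auto)
        qed
      qed
      then show ?thesis using ij by blast
    qed
  qed
  then obtain c where "c < 2 * r" "\<And>k. k < 2 * r \<Longrightarrow> W c k (int r - 1)" by blast
  moreover have "\<exists>l<r. (xs ! c, xs ! k) \<in> E ^^ l" if "W c k (int r - 1)" for k
    using that unfolding W_def by force
  ultimately show ?thesis by blast
qed

text \<open>An edge between even positions is an even chord, whose centre contradicts
  \<open>rad\<close>. \<open>rad\<close> stays inside \<open>set xs\<close> because the path will be
  Hamiltonian.\<close>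

lemma even_positions_independent:
  assumes path: "is_path E xs" "length xs = 2 * r" and "sym E" "irrefl E"
    and rad: "\<And>v. v \<in> set xs \<Longrightarrow> \<exists>u\<in>set xs. \<forall>k<r. (v, u) \<notin> E ^^ k"
  shows "pairwise (\<lambda>u v. (u, v) \<notin> E) ((\<lambda>i. xs ! (2 * i)) ` {..<r})"
proof -
  have no: "(xs ! (2 * i), xs ! (2 * j)) \<notin> E" if "i < j" "j < r" for i j
  proof
    assume "(xs ! (2 * i), xs ! (2 * j)) \<in> E"
    then obtain c where c: "c < 2 * r" "\<And>k. k < 2 * r \<Longrightarrow> \<exists>l<r. (xs ! c, xs ! k) \<in> E ^^ l"
      using even_chord_small_eccentricity[OF path \<open>sym E\<close>, of "2 * i" "2 * j"] \<open>i < j\<close> \<open>j < r\<close>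
      by auto
    have "xs ! c \<in> set xs" using c(1) path(2) by simp
    then show False
      using rad c(2) path(2) by (metis in_set_conv_nth)
  qed
  then have "(xs ! (2 * i), xs ! (2 * j)) \<notin> E" if "i < r" "j < r" for i j
    using that \<open>sym E\<close> \<open>irrefl E\<close>
    by (cases i j rule: linorder_cases) (auto simp: irrefl_def dest: symD)
  then show ?thesis by (auto simp: pairwise_def)
qed

section \<open>Bounds on the independence number\<close>

lemma finite_independent_sets: "finite (pverts G) \<Longrightarrow> finite {S. independent_set G S}"
  by (rule finite_subset[of _ "Pow (pverts G)"]) (auto simp: independent_set_def)

lemma independent_card_le_independence_number:
  "finite (pverts G) \<Longrightarrow> independent_set G S \<Longrightarrow> card S \<le> independence_number G"
  unfolding independence_number_def by (intro Max_ge) (auto simp: finite_independent_sets)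

lemma independence_number_le:
  assumes "finite (pverts G)" "\<And>S. independent_set G S \<Longrightarrow> card S \<le> k"
  shows "independence_number G \<le> k"
proof -
  have "independent_set G {}" by (simp add: independent_set_def)
  then show ?thesis
    unfolding independence_number_def using assms
    by (intro Max.boundedI) (auto simp: finite_independent_sets)
qed

context pair_graph
begin

lemma path_of_radius:
  assumes "Digraph_Component.connected (with_proj G)" "radius G = ereal (real r)"
  obtains xs where "is_path (parcs G) xs" "set xs \<subseteq> pverts G" "length xs = 2 * r"
proof -
  have "parcs G \<subseteq> pverts G \<times> pverts G"
    by (auto intro: in_arcsD1 in_arcsD2)
  then show thesis
    using long_path_exists[of "pverts G" "parcs G" r] pair_finite_verts assms(1) sym_parcs
      walk_ge_radius[OF assms(2)] that
    by (auto simp: connected_iff_rtrancl)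
qed

lemma independence_number_add_radius_le:
  assumes "Digraph_Component.connected (with_proj G)" "radius G = ereal (real r)"
  shows "independence_number G + r \<le> card (pverts G)"
proof -
  obtain xs where xs: "is_path (parcs G) xs" "set xs \<subseteq> pverts G" "length xs = 2 * r"
    using path_of_radius[OF assms] .
  have *: "card S + r \<le> card (pverts G)" if "independent_set G S" for S
    using independent_meets_path[OF xs(1,3) pair_finite_verts xs(2)] that
    by (auto simp: independent_set_def)
  \<comment> \<open>Keeps the next subtraction from truncating.\<close>
  have "r \<le> card (pverts G)" using *[of "{}"] by (simp add: independent_set_def)
  moreover have "independence_number G \<le> card (pverts G) - r"
    using * by (intro independence_number_le pair_finite_verts) (simp add: le_diff_conv2 \<open>r \<le> _\<close>)
  ultimately show ?thesis by linarith
qed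

text \<open>Leaves only the Hamiltonian case and the construction.\<close>

lemma order_ge_twice_radius:
  assumes "Digraph_Component.connected (with_proj G)" "radius G = ereal (real r)"
  shows "2 * r \<le> card (pverts G)"
  using path_of_radius[OF assms] pair_finite_verts
  by (metis card_mono distinct_card is_path_def)

lemma independence_number_minimal_order:
  assumes "Digraph_Component.connected (with_proj G)" "radius G = ereal (real r)"
    and "card (pverts G) = 2 * r"
  shows "r \<le> independence_number G"
proof -
  obtain xs where xs: "is_path (parcs G) xs" "set xs \<subseteq> pverts G" "length xs = 2 * r"
    using path_of_radius[OF assms(1,2)] .
  have V: "set xs = pverts G"
    using xs assms(3) pair_finite_verts
    by (metis card_subset_eq distinct_card is_path_def)
  let ?S = "(\<lambda>i. xs ! (2 * i)) ` {..<r}"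
  have "irrefl (parcs G)" using pair_no_loops by (force simp: irrefl_def)
  then have "pairwise (\<lambda>u v. (u, v) \<notin> parcs G) ?S"
    using even_positions_independent[OF xs(1,3) sym_parcs] walk_ge_radius[OF assms(2)] V by simp
  then have "independent_set G ?S"
    using xs(3) V unfolding independent_set_def by (auto intro!: nth_mem simp flip: V)
  moreover have "card ?S = r"
    using xs(1,3) by (subst card_image) (auto intro!: inj_onI simp: is_path_def nth_eq_iff_index_eq)
  ultimately show ?thesis
    using independent_card_le_independence_number[OF pair_finite_verts] by metis
qed

end

section \<open>Blowing up an even cycle with a pendant vertex\<close>

text \<open>
  Labels below \<open>2 * r\<close> form a cycle, and the label \<open>2 * r\<close> is a leaf attached to \<open>0\<close>.
  All vertices carrying the label \<open>1\<close> are nonadjacent twins; any other label occurs once.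
\<close>
locale cycle_with_pendant =
  fixes V :: "'a set" and lab :: "'a \<Rightarrow> nat" and r :: nat
  assumes finV: "finite V" and r2: "2 \<le> r" and lab_image: "lab ` V = {..2 * r}"
    and twins: "\<And>x y. x \<in> V \<Longrightarrow> y \<in> V \<Longrightarrow> lab x = lab y \<Longrightarrow> x \<noteq> y \<Longrightarrow> lab x = 1"
begin

text \<open>Difference \<open>2 * int r - 1\<close> is the closing edge between \<open>0\<close> and
  \<open>2 * r - 1\<close>.\<close>

definition adj :: "nat \<Rightarrow> nat \<Rightarrow> bool" where
  "adj a b \<longleftrightarrow> a < 2 * r \<and> b < 2 * r \<and> (\<bar>int a - int b\<bar> = 1 \<or> \<bar>int a - int b\<bar> = 2 * int r - 1)
    \<or> a = 2 * r \<and> b = 0 \<or> a = 0 \<and> b = 2 * r"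

text \<open>Label distance from a cycle label \<open>i\<close>: the shorter arc, or for the leaf one
  more than the distance to \<open>0\<close>.\<close>

definition ldist :: "nat \<Rightarrow> nat \<Rightarrow> int" where
  "ldist i b = (if b = 2 * r then 1 + min (int i) (2 * int r - int i)
     else min \<bar>int b - int i\<bar> (2 * int r - \<bar>int b - int i\<bar>))"

lemma adj_sym: "adj a b \<Longrightarrow> adj b a"
  by (auto simp: adj_def)

text \<open>Lower-bound half: a walk is at least as long as the change of \<open>ldist i\<close>
  between its ends.\<close>

lemma ldist_lipschitz:
  assumes "adj a b" "i < 2 * r"
  shows "ldist i b \<le> ldist i a + 1"
proof -
  consider "a < 2 * r" "b < 2 * r" "\<bar>int a - int b\<bar> = 1"
    | "a < 2 * r" "b < 2 * r" "\<bar>int a - int b\<bar> = 2 * int r - 1"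
    | "a = 2 * r" "b = 0" | "a = 0" "b = 2 * r"
    using assms by (auto simp: adj_def)
  then show ?thesis
    using assms(2) by cases (simp_all add: ldist_def, linarith?)
qed

lemma ldist_eq_0_iff: "i < 2 * r \<Longrightarrow> b \<le> 2 * r \<Longrightarrow> ldist i b = 0 \<longleftrightarrow> b = i"
  by (simp add: ldist_def, linarith)

lemma ldist_nonneg: "i < 2 * r \<Longrightarrow> b \<le> 2 * r \<Longrightarrow> 0 \<le> ldist i b"
  by (simp add: ldist_def, linarith)

text \<open>Only \<open>r\<close>, antipodal to \<open>0\<close>, is \<open>r + 1\<close> away from
  the leaf.\<close>

lemma ldist_le: "i < 2 * r \<Longrightarrow> b \<le> 2 * r \<Longrightarrow> i \<noteq> r \<Longrightarrow> ldist i b \<le> int r"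
  by (simp add: ldist_def, linarith)

text \<open>Upper-bound half: repeated descent traces a shortest walk to \<open>i\<close>.\<close>

lemma ldist_descent:
  assumes "i < 2 * r" "b \<le> 2 * r" "b \<noteq> i"
  shows "\<exists>c\<le>2 * r. adj b c \<and> ldist i c = ldist i b - 1"
proof -
  \<comment> \<open>The shorter way round decides between stepping down and up;
    \<open>2 * r - 1\<close> and \<open>0\<close> may wrap.\<close>
  consider (pendant) "b = 2 * r"
    | (down) "b < 2 * r" "i < b" "b \<le> i + r"
    | (wrap_up) "Suc b = 2 * r" "i + r < b"
    | (far_up) "Suc b < 2 * r" "i + r < b"
    | (up) "b < i" "i \<le> b + r"
    | (wrap_down) "b = 0" "r < i"
    | (far_down) "0 < b" "b + r < i"
  proof (cases "b = 2 * r \<or> i < b")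
    case True
    then show thesis using that(1-4) assms(2) by (meson Suc_lessI le_neq_implies_less not_le)
  next
    case False
    then show thesis using that(5-7) assms(3) by (cases "b = 0") (simp; linarith)+
  qed
  then show ?thesis
  proof cases
    case pendant
    then show ?thesis
      using assms r2 by (intro exI[of _ 0]) (simp add: adj_def ldist_def)
  next
    case down
    then obtain b' where "b = Suc b'" by (cases b) auto
    with down show ?thesis
      using assms r2 by (intro exI[of _ b']) (simp add: adj_def ldist_def)
  next
    case wrap_up
    then show ?thesis
      using assms r2 by (intro exI[of _ 0]) (simp add: adj_def ldist_def)
  next
    case far_up
    then show ?thesis
      using assms r2 by (intro exI[of _ "Suc b"]) (simp add: adj_def ldist_def)
  next
    case up
    then show ?thesis
      using assms r2 by (intro exI[of _ "Suc b"]) (simp add: adj_def ldist_def)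
  next
    case wrap_down
    then show ?thesis
      using assms r2 by (intro exI[of _ "2 * r - 1"]) (simp add: adj_def ldist_def of_nat_diff)
  next
    case far_down
    then obtain b' where "b = Suc b'" by (cases b) auto
    with far_down show ?thesis
      using assms r2 by (intro exI[of _ b']) (simp add: adj_def ldist_def)
  qed
qed

section \<open>The blown-up graph and its walks\<close>

definition G :: "'a pair_pre_digraph" where
  "G = \<lparr>pverts = V, parcs = {(x, y). x \<in> V \<and> y \<in> V \<and> adj (lab x) (lab y)}\<rparr>"

lemma pverts_G [simp]: "pverts G = V"
  by (simp add: G_def)

lemma parcs_G [simp]: "(x, y) \<in> parcs G \<longleftrightarrow> x \<in> V \<and> y \<in> V \<and> adj (lab x) (lab y)"
  by (simp add: G_def)

sublocale pair_graph G
proof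
  have "parcs G \<subseteq> V \<times> V" by auto
  then show "finite (parcs G)" using finV finite_subset by blast
  show "symmetric (with_proj G)"
    by (auto simp: symmetric_def intro!: symI dest: adj_sym)
  show "fst e \<noteq> snd e" if "e \<in> parcs G" for e
    using that r2 by (cases e) (auto simp: adj_def)
qed (use finV in auto)

lemma lab_le: "x \<in> V \<Longrightarrow> lab x \<le> 2 * r"
  using lab_image by auto

lemma ex_lab: "a \<le> 2 * r \<Longrightarrow> \<exists>x\<in>V. lab x = a"
  using lab_image by (metis atMost_iff imageE)

lemma card_lab:
  assumes "L \<subseteq> {..2 * r} - {1}"
  shows "card {x \<in> V. lab x \<in> L} = card L"
proof (rule bij_betw_same_card)
  have "inj_on lab {x \<in> V. lab x \<in> L}"
    using assms twins by (intro inj_onI) blast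
  moreover have "lab ` {x \<in> V. lab x \<in> L} = L"
    using assms ex_lab by (fastforce simp: image_iff)
  ultimately show "bij_betw lab {x \<in> V. lab x \<in> L} L"
    by (simp add: bij_betw_def)
qed

text \<open>\<open>ldist\<close> cannot tell \<open>x\<close> from its twins, so the fourth
  assumption excludes starting in a twin.\<close>

lemma walk_to:
  assumes "x \<in> V" "lab x < 2 * r" "y \<in> V" "lab y = lab x \<Longrightarrow> y = x"
    "ldist (lab x) (lab y) = int k"
  shows "(y, x) \<in> parcs G ^^ k"
  using assms(3-)
proof (induction k arbitrary: y)
  case 0
  then show ?case using ldist_eq_0_iff[of "lab x" "lab y"] assms lab_le by auto
next
  case (Suc k)
  have "lab y \<noteq> lab x"
    using Suc.prems(3) ldist_eq_0_iff[of "lab x" "lab y"] assms(2) lab_le[OF Suc.prems(1)] by auto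
  then obtain c where c: "c \<le> 2 * r" "adj (lab y) c" "ldist (lab x) c = int k"
    using ldist_descent[of "lab x" "lab y"] assms(2) lab_le[OF Suc.prems(1)] Suc.prems(3) by auto
  \<comment> \<open>On reaching the label of \<open>x\<close>, take \<open>x\<close> itself and not
    a twin.\<close>
  obtain z where z: "z \<in> V" "lab z = c" "c = lab x \<Longrightarrow> z = x"
    using ex_lab[OF c(1)] assms(1) by metis
  then have "(z, x) \<in> parcs G ^^ k"
    using Suc.IH[of z] c by auto
  moreover have "(y, z) \<in> parcs G" using z c Suc.prems by auto
  ultimately show ?case by (rule relpow_Suc_I2[rotated])
qed

text \<open>Twins have label distance 0 but are joined in 2 steps through label \<open>0\<close>;
  hence \<open>max 2\<close>, harmless since \<open>r \<ge> 2\<close>.\<close>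

lemma walk_from_le:
  assumes "x \<in> V" "lab x < 2 * r" "y \<in> V"
  shows "\<exists>k. int k \<le> max 2 (ldist (lab x) (lab y)) \<and> (x, y) \<in> parcs G ^^ k"
proof -
  have "\<exists>k. int k \<le> max 2 (ldist (lab x) (lab y)) \<and> (y, x) \<in> parcs G ^^ k"
  proof (cases "lab y = lab x \<and> y \<noteq> x")
    case True
    then have l: "lab y = 1" "lab x = 1" using twins assms by auto
    obtain z where z: "z \<in> V" "lab z = 0" using ex_lab[of 0] by auto
    have "(y, z) \<in> parcs G" "(z, x) \<in> parcs G"
      using l z assms r2 by (auto simp: adj_def)
    then have "(y, x) \<in> parcs G ^^ 2" by (auto simp: numeral_2_eq_2)
    then show ?thesis by (intro exI[of _ 2]) auto
  next
    case False
    have "0 \<le> ldist (lab x) (lab y)" using assms lab_le by (intro ldist_nonneg) auto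
    then show ?thesis
      using walk_to[OF assms, of "nat (ldist (lab x) (lab y))"] False
      by (intro exI[of _ "nat (ldist (lab x) (lab y))"]) auto
  qed
  then show ?thesis using sym_relpow[OF sym_parcs] by (meson symD)
qed

section \<open>Eccentricities, radius and central vertices\<close>

lemma ldist_le_walk:
  assumes "i < 2 * r" "(x, y) \<in> parcs G ^^ k"
  shows "ldist i (lab y) \<le> ldist i (lab x) + int k"
  using assms(2)
proof (induction k arbitrary: y)
  case (Suc k)
  then obtain z where "(x, z) \<in> parcs G ^^ k" "(z, y) \<in> parcs G" by auto
  then show ?case using Suc.IH[of z] ldist_lipschitz[of "lab z" "lab y" i] assms(1) by auto
qed simp

text \<open>The base \<open>i\<close> is free so that \<open>x\<close> may be the leaf, which is no
  base point itself; reversing walks gives the absolute value.\<close>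

lemma eccentricity_ge:
  assumes "x \<in> V" "y \<in> V" "i < 2 * r" "int c \<le> \<bar>ldist i (lab y) - ldist i (lab x)\<bar>"
  shows "ereal (real c) \<le> eccentricity G x"
proof -
  have "c \<le> k" if "(x, y) \<in> parcs G ^^ k" for k
    using ldist_le_walk[OF assms(3) that] ldist_le_walk[OF assms(3), of y x k]
      symD[OF sym_relpow[OF sym_parcs] that] assms(4) by linarith
  then have "ereal (real c) \<le> gdist G x y" by (rule gdist_ge)
  also have "\<dots> \<le> eccentricity G x"
    unfolding eccentricity_def using finV assms by (intro Max_ge) auto
  finally show ?thesis .
qed

lemma eccentricity_le:
  assumes "x \<in> V" "lab x < 2 * r" "lab x \<noteq> r"
  shows "eccentricity G x \<le> ereal (real r)"
  unfolding eccentricity_def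
proof (rule Max.boundedI)
  fix d assume "d \<in> gdist G x ` pverts G"
  then obtain y where y: "y \<in> V" "d = gdist G x y" by auto
  obtain k where k: "int k \<le> max 2 (ldist (lab x) (lab y))" "(x, y) \<in> parcs G ^^ k"
    using walk_from_le[OF assms(1,2) y(1)] by blast
  have "k \<le> r" using k(1) ldist_le[OF assms(2) lab_le[OF y(1)] assms(3)] r2 by auto
  moreover have "gdist G x y \<le> ereal (real k)" using gdist_le_walk[OF k(2)] assms(1) by simp
  ultimately show "d \<le> ereal (real r)" using y(2) by (auto elim!: order_trans)
qed (use finV assms in auto)

lemma eccentricity_central:
  assumes "x \<in> V" "lab x < 2 * r" "lab x \<noteq> r"
  shows "eccentricity G x = ereal (real r)"
proof (rule antisym)
  \<comment> \<open>The label antipodal to \<open>lab x\<close> on the cycle.\<close>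
  define a where "a = (if lab x < r then lab x + r else lab x - r)"
  have a: "a \<le> 2 * r" "ldist (lab x) a = int r" "ldist (lab x) (lab x) = 0"
    using assms unfolding a_def ldist_def by auto
  obtain y where "y \<in> V" "lab y = a" using ex_lab[OF a(1)] by blast
  then show "ereal (real r) \<le> eccentricity G x"
    using a assms by (intro eccentricity_ge[of x y "lab x"]) auto
qed (rule eccentricity_le[OF assms])

text \<open>The leaf and the vertex labelled \<open>r\<close> are \<open>r + 1\<close> apart,
  measured from base \<open>r\<close> in both cases.\<close>

lemma eccentricity_noncentral:
  assumes "x \<in> V" "lab x = r \<or> lab x = 2 * r"
  shows "ereal (real (Suc r)) \<le> eccentricity G x"
proof -
  obtain y where "y \<in> V" "lab y = (if lab x = r then 2 * r else r)"
    using ex_lab[of "if lab x = r then 2 * r else r"] by (metis le_add1 mult_2 order_refl)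
  then show ?thesis
    using assms r2 by (intro eccentricity_ge[of x y r]) (auto simp: ldist_def)
qed

lemma eccentricity_cases:
  "x \<in> V \<Longrightarrow> eccentricity G x = ereal (real r) \<longleftrightarrow> lab x \<notin> {r, 2 * r}"
  "x \<in> V \<Longrightarrow> ereal (real r) \<le> eccentricity G x"
proof -
  assume x: "x \<in> V"
  have "ereal (real r) < eccentricity G x" if "lab x \<in> {r, 2 * r}"
    using less_le_trans[OF _ eccentricity_noncentral[OF x], of "ereal (real r)"] that by auto
  moreover have "eccentricity G x = ereal (real r)" if "lab x \<notin> {r, 2 * r}"
    using eccentricity_central[OF x] lab_le[OF x] that by auto
  ultimately show "eccentricity G x = ereal (real r) \<longleftrightarrow> lab x \<notin> {r, 2 * r}"
    "ereal (real r) \<le> eccentricity G x"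
    by force+
qed

lemma radius_G: "radius G = ereal (real r)"
  unfolding radius_def
proof (rule Min_eqI)
  obtain x where "x \<in> V" "lab x = 0" using ex_lab[of 0] by auto
  then show "ereal (real r) \<in> eccentricity G ` pverts G"
    using eccentricity_central[of x] r2 by force
next
  show "ereal (real r) \<le> e" if "e \<in> eccentricity G ` pverts G" for e
    using that eccentricity_cases(2) by (metis imageE pverts_G)
next
  show "finite (eccentricity G ` pverts G)"
    unfolding pverts_G by (rule finite_imageI[OF finV])
qed

lemma connected_G: "Digraph_Component.connected (with_proj G)"
proof -
  obtain x where x: "x \<in> V" "lab x = 0" using ex_lab[of 0] by auto
  have to: "(x, y) \<in> (parcs G)\<^sup>*" if "y \<in> V" for y
  proof -
    have "lab x < 2 * r" using x(2) r2 by simp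
    then show ?thesis using walk_from_le[OF x(1) _ that] relpow_imp_rtrancl by metis
  qed
  then have "(y, x) \<in> (parcs G)\<^sup>*" if "y \<in> V" for y
    using that sym_parcs by (meson sym_rtrancl symD)
  with to have "(u, v) \<in> (parcs G)\<^sup>*" if "u \<in> V" "v \<in> V" for u v
    using that by (meson rtrancl_trans)
  then show ?thesis unfolding connected_iff_rtrancl using x by auto
qed

text \<open>As \<open>r \<ge> 2\<close>, the noncentral labels \<open>r\<close> and
  \<open>2 * r\<close> differ from \<open>1\<close>, so each sits on a single vertex.\<close>

lemma card_central_vertices: "card (central_vertices G) + 2 = card V"
proof -
  have "central_vertices G = V - {x \<in> V. lab x \<in> {r, 2 * r}}"
    unfolding central_vertices_def radius_G using eccentricity_cases(1) by auto
  moreover have "card {x \<in> V. lab x \<in> {r, 2 * r}} = 2"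
    using r2 by (subst card_lab) auto
  moreover have "card {x \<in> V. lab x \<in> {r, 2 * r}} \<le> card V"
    using finV by (intro card_mono) auto
  ultimately show ?thesis using finV by (simp add: card_Diff_subset)
qed

lemma almost_self_centered_G: "almost_self_centered G"
  unfolding almost_self_centered_def
  using connected_G card_central_vertices pair_graph by auto

text \<open>Cycle edges join labels of different parity and the leaf edge contains \<open>0\<close>,
  so the even labels below \<open>2 * r\<close> cover all edges. Each sits on one vertex; all twins
  stay in the independent set.\<close>

lemma independence_number_G: "card V \<le> independence_number G + r"
proof -
  define L where "L = (\<lambda>i. 2 * i) ` {..<r}"
  let ?S = "V - {x \<in> V. lab x \<in> L}"
  have even_L: "a \<in> L" if "even a" "a < 2 * r" for a
    using that unfolding L_def by (auto elim!: evenE)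
  have "adj a b \<Longrightarrow> a \<in> L \<or> b \<in> L" for a b
  proof -
    assume "adj a b"
    moreover have "even a \<noteq> even b" if "\<bar>int a - int b\<bar> = 1 \<or> \<bar>int a - int b\<bar> = 2 * int r - 1"
    proof -
      have "odd \<bar>int a - int b\<bar>" using that by fastforce
      then show ?thesis by simp
    qed
    ultimately consider "a < 2 * r" "b < 2 * r" "even a \<noteq> even b" | "a = 0" | "b = 0"
      unfolding adj_def by blast
    then show ?thesis using even_L r2 by cases auto
  qed
  then have "independent_set G ?S"
    unfolding independent_set_def pairwise_def by auto
  then have "card ?S \<le> independence_number G"
    by (intro independent_card_le_independence_number) (simp add: finV)
  moreover have "card {x \<in> V. lab x \<in> L} = r"
  proof (subst card_lab)
    show "L \<subseteq> {..2 * r} - {1}" unfolding L_def by auto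
    show "card L = r" unfolding L_def by (subst card_image) (auto simp: inj_on_def)
  qed
  ultimately show ?thesis using finV by (simp add: card_Diff_subset)
qed

end

text \<open>Number the vertices from 0 and send surplus numbers above \<open>2 * r\<close> to label
  \<open>1\<close>; strictness makes the leaf label occur.\<close>

lemma ex_cycle_with_pendant:
  assumes "finite V" "2 \<le> r" "2 * r < card V"
  shows "\<exists>lab. cycle_with_pendant V lab r"
proof -
  obtain g where g: "bij_betw g V {0..<card V}"
    using ex_bij_betw_finite_nat[OF assms(1)] by blast
  define lab where "lab x = (if g x \<le> 2 * r then g x else 1)" for x
  have "lab ` V = (\<lambda>i. if i \<le> 2 * r then i else 1) ` {0..<card V}"
    unfolding lab_def bij_betw_imp_surj_on[OF g, symmetric] image_image ..
  also have "\<dots> = {..2 * r}" using assms by (auto simp: image_iff)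
  finally have "lab ` V = {..2 * r}" .
  moreover have "lab x = 1" if "x \<in> V" "y \<in> V" "lab x = lab y" "x \<noteq> y" for x y
    using that inj_onD[OF bij_betw_imp_inj_on[OF g], of x y]
    unfolding lab_def by (auto split: if_splits)
  ultimately have "cycle_with_pendant V lab r"
    using assms by unfold_locales auto
  then show ?thesis by blast
qed

theorem theorem6:
  fixes n r :: nat
  assumes "r \<ge> 2"
    and "(asc_graphs n r :: 'a pair_pre_digraph set) \<noteq> {}"
  shows "(\<exists>G \<in> (asc_graphs n r :: 'a pair_pre_digraph set). independence_number G = n - r) \<and>
         (\<forall>G \<in> (asc_graphs n r :: 'a pair_pre_digraph set). independence_number G \<le> n - r)"
proof -
  have upper: "independence_number G + r \<le> n"
    if "G \<in> asc_graphs n r" for G :: "'a pair_pre_digraph"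
    using that pair_graph.independence_number_add_radius_le[of G r]
    by (auto simp: asc_graphs_def almost_self_centered_def)
  \<comment> \<open>\<open>G0\<close> is itself extremal when \<open>n = 2 * r\<close>; otherwise it
    supplies \<open>n\<close> vertices of type \<open>'a\<close> for the construction.\<close>
  obtain G0 :: "'a pair_pre_digraph" where G0: "G0 \<in> asc_graphs n r"
    using assms(2) by blast
  then interpret G0: pair_graph G0
    by (simp add: asc_graphs_def almost_self_centered_def)
  have G0_props: "Digraph_Component.connected (with_proj G0)" "radius G0 = ereal (real r)"
    "card (pverts G0) = n"
    using G0 by (auto simp: asc_graphs_def almost_self_centered_def)
  have "\<exists>G \<in> (asc_graphs n r :: 'a pair_pre_digraph set). n \<le> independence_number G + r"
  proof (cases "n = 2 * r")
    case True
    then show ?thesis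
      using G0.independence_number_minimal_order G0_props G0 by (intro bexI[of _ G0]) auto
  next
    case False
    then have "2 * r < card (pverts G0)"
      using G0.order_ge_twice_radius[OF G0_props(1,2)] G0_props(3) by simp
    then obtain lab where "cycle_with_pendant (pverts G0) lab r"
      using ex_cycle_with_pendant[OF G0.pair_finite_verts assms(1)] by blast
    then interpret C: cycle_with_pendant "pverts G0" lab r .
    have "C.G \<in> asc_graphs n r"
      using C.almost_self_centered_G C.radius_G G0_props(3) by (simp add: asc_graphs_def)
    then show ?thesis using C.independence_number_G G0_props(3) by blast
  qed
  then show ?thesis using upper by (metis add_le_imp_le_diff diff_add_inverse2 le_antisym)
qed

end
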